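(* Let $n\ge 1$ and let $(G,o)$ be a Menger algebra of rank $n$, with operation written $o(x,y_1,\ldots,y_n)=x[y_1\ldots y_n]$. Then $(G,o)$ is isomorphic to a Menger algebra of $n$-place interior operations on some set $A$ if and only if it satisfies the following three identities for all $x,y,y_1,\ldots,y_n\in G$: \[ x[x\ldots x]=x, \] \[ x[y\ldots y]=y[x\ldots x], \] \[ x[y_1\ldots y_n]=x[y_1\ldots y_1][y_2\ldots y_2]\ldots[y_n\ldots y_n]. \]
   Context: A Menger algebra of rank $n$ is a nonempty set $G$ with an $(n+1)$-ary operation $o\colon (f,g_1,\ldots,g_n)\mapsto f[g_1\ldots g_n]$ satisfying the superassociative law $f[g_1\ldots g_n][h_1\ldots h_n]=f[g_1[h_1\ldots h_n]\ldots g_n[h_1\ldots h_n]]$. Iterated brackets are read from left to right, i.e. $x[y_1\ldots y_n][z_1\ldots z_n]$ means $(x[y_1\ldots y_n])[z_1\ldots z_n]$; in the third identity each bracket $[y_i\ldots y_i]$ contains $y_i$ repeated $n$ times, and similarly $[x\ldots x]$, $[y\ldots y]$ contain $n$ copies. For a nonempty set $A$, $\mathfrak{P}(A)$ is the family of all subsets of $A$ and $\mathcal{T}_n(\mathfrak{P}(A))$ is the set of all maps $f\colon \mathfrak{P}(A)^n\to\mathfrak{P}(A)$ ($n$-place transformations of $\mathfrak{P}(A)$). The Menger superposition is $f[g_1\ldots g_n](X_1,\ldots,X_n)=f(g_1(X_1,\ldots,X_n),\ldots,g_n(X_1,\ldots,X_n))$. An $n$-place transformation $f$ is contractive if $f(X_1,\ldots,X_n)\subseteq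 X_1\cap\dots\cap X_n$ for all $X_1,\ldots,X_n$; idempotent if $f[f\ldots f]=f$; isotone if $X_1\subseteq Y_1,\ldots,X_n\subseteq Y_n$ imply $f(X_1,\ldots,X_n)\subseteq f(Y_1,\ldots,Y_n)$. An $n$-place interior operation on $A$ is an $n$-place transformation of $\mathfrak{P}(A)$ that is contractive, idempotent and isotone. A Menger algebra of $n$-place interior operations on $A$ is a nonempty set $\Phi\subseteq\mathcal{T}_n(\mathfrak{P}(A))$, all of whose elements are $n$-place interior operations on $A$, closed under Menger superposition and equipped with it as operation. An isomorphism of Menger algebras of rank $n$ is a bijection $P$ with $P(g[g_1\ldots g_n])=P(g)[P(g_1)\ldots P(g_n)]$. *)

theory Defs
  imports "HOL-Library.FuncSet" "HOL-Library.NList"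
begin

(* An n-tuple over S is a list in nlists n S, so f[g_1 ... g_n] is written  opn f [g_1, ..., g_n]. *)

definition menger_algebra :: "nat \<Rightarrow> 'g set \<Rightarrow> ('g \<Rightarrow> 'g list \<Rightarrow> 'g) \<Rightarrow> bool" where
  "menger_algebra n G opn \<longleftrightarrow>
     G \<noteq> {} \<and>
     (\<forall>f\<in>G. \<forall>gs\<in>nlists n G. opn f gs \<in> G) \<and>
     (\<forall>f\<in>G. \<forall>gs\<in>nlists n G. \<forall>hs\<in>nlists n G.
        opn (opn f gs) hs = opn f (map (\<lambda>g. opn g hs) gs))"

definition menger_iso ::
  "nat \<Rightarrow> 'g set \<Rightarrow> ('g \<Rightarrow> 'g list \<Rightarrow> 'g) \<Rightarrow> 'h set \<Rightarrow> ('h \<Rightarrow> 'h list \<Rightarrow> 'h) \<Rightarrow> ('g \<Rightarrow> 'h) \<Rightarrow> bool" where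
  "menger_iso n G opn H opn' P \<longleftrightarrow>
     bij_betw P G H \<and>
     (\<forall>g\<in>G. \<forall>gs\<in>nlists n G. P (opn g gs) = opn' (P g) (map P gs))"

(* The maps Pow(A)^n -> Pow(A) are taken to be extensional (undefined off their domain), so that
   HOL equality of two of them is equality as maps on Pow(A)^n. *)

definition transformations :: "nat \<Rightarrow> 'a set \<Rightarrow> ('a set list \<Rightarrow> 'a set) set" where
  "transformations n A = nlists n (Pow A) \<rightarrow>\<^sub>E Pow A"

definition superposition ::
  "nat \<Rightarrow> 'a set \<Rightarrow> ('a set list \<Rightarrow> 'a set) \<Rightarrow> ('a set list \<Rightarrow> 'a set) list \<Rightarrow> ('a set list \<Rightarrow> 'a set)" where
  "superposition n A f gs = (\<lambda>Xs\<in>nlists n (Pow A). f (map (\<lambda>g. g Xs) gs))"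

definition contractive :: "nat \<Rightarrow> 'a set \<Rightarrow> ('a set list \<Rightarrow> 'a set) \<Rightarrow> bool" where
  "contractive n A f \<longleftrightarrow> (\<forall>Xs\<in>nlists n (Pow A). f Xs \<subseteq> \<Inter>(set Xs))"

definition idempotent :: "nat \<Rightarrow> 'a set \<Rightarrow> ('a set list \<Rightarrow> 'a set) \<Rightarrow> bool" where
  "idempotent n A f \<longleftrightarrow> superposition n A f (replicate n f) = f"

definition isotone :: "nat \<Rightarrow> 'a set \<Rightarrow> ('a set list \<Rightarrow> 'a set) \<Rightarrow> bool" where
  "isotone n A f \<longleftrightarrow>
     (\<forall>Xs\<in>nlists n (Pow A). \<forall>Ys\<in>nlists n (Pow A). list_all2 (\<subseteq>) Xs Ys \<longrightarrow> f Xs \<subseteq> f Ys)"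

definition interior_operation :: "nat \<Rightarrow> 'a set \<Rightarrow> ('a set list \<Rightarrow> 'a set) \<Rightarrow> bool" where
  "interior_operation n A f \<longleftrightarrow>
     f \<in> transformations n A \<and> contractive n A f \<and> idempotent n A f \<and> isotone n A f"

definition interior_operation_algebra :: "nat \<Rightarrow> 'a set \<Rightarrow> ('a set list \<Rightarrow> 'a set) set \<Rightarrow> bool" where
  "interior_operation_algebra n A \<Phi> \<longleftrightarrow>
     A \<noteq> {} \<and> \<Phi> \<noteq> {} \<and>
     (\<forall>f\<in>\<Phi>. interior_operation n A f) \<and>
     (\<forall>f\<in>\<Phi>. \<forall>gs\<in>nlists n \<Phi>. superposition n A f gs \<in> \<Phi>)"

lemma interior_operation_algebra_menger:
  assumes "interior_operation_algebra n A \<Phi>"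
  shows "menger_algebra n \<Phi> (superposition n A)"
proof -
  have nonempty: "\<Phi> \<noteq> {}" and op: "\<And>f. f \<in> \<Phi> \<Longrightarrow> interior_operation n A f"
    and closed: "\<And>f gs. f \<in> \<Phi> \<Longrightarrow> gs \<in> nlists n \<Phi> \<Longrightarrow> superposition n A f gs \<in> \<Phi>"
    using assms unfolding interior_operation_algebra_def by simp_all
  have "superposition n A (superposition n A f gs) hs
      = superposition n A f (map (\<lambda>g. superposition n A g hs) gs)"
    if "hs \<in> nlists n \<Phi>" for f gs hs
  proof
    fix Xs
    have "map (\<lambda>h. h Xs) hs \<in> nlists n (Pow A)" if Xs: "Xs \<in> nlists n (Pow A)"
    proof (rule nlistsI)
      show "length (map (\<lambda>h. h Xs) hs) = n"
        using \<open>hs \<in> nlists n \<Phi>\<close> by simp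
      have "h Xs \<in> Pow A" if "h \<in> set hs" for h
      proof -
        have "interior_operation n A h"
          using nlistsE_set[OF \<open>hs \<in> nlists n \<Phi>\<close>] that by (intro op) (rule subsetD)
        then have "h \<in> nlists n (Pow A) \<rightarrow>\<^sub>E Pow A"
          unfolding interior_operation_def transformations_def by (rule conjunct1)
        then show ?thesis
          using Xs by (rule PiE_mem)
      qed
      then show "set (map (\<lambda>h. h Xs) hs) \<subseteq> Pow A"
        unfolding set_map by (rule image_subsetI)
    qed
    then show "superposition n A (superposition n A f gs) hs Xs
      = superposition n A f (map (\<lambda>g. superposition n A g hs) gs) Xs"
      unfolding superposition_def by (cases "Xs \<in> nlists n (Pow A)") (simp_all add: comp_def)
  qed
  then show ?thesis
    unfolding menger_algebra_def by (intro conjI ballI nonempty closed)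
qed

definition isomorphic_to_interior_operations ::
  "nat \<Rightarrow> 'g set \<Rightarrow> ('g \<Rightarrow> 'g list \<Rightarrow> 'g) \<Rightarrow> 'a set \<Rightarrow> bool" where
  "isomorphic_to_interior_operations n G opn A \<longleftrightarrow>
     (\<exists>\<Phi> P. interior_operation_algebra n A \<Phi> \<and> menger_iso n G opn \<Phi> (superposition n A) P)"

(* The fold is x[y_1 ... y_1][y_2 ... y_2] ... [y_n ... y_n], bracketed to the left. *)

definition interior_identities :: "nat \<Rightarrow> 'g set \<Rightarrow> ('g \<Rightarrow> 'g list \<Rightarrow> 'g) \<Rightarrow> bool" where
  "interior_identities n G opn \<longleftrightarrow>
     (\<forall>x\<in>G. opn x (replicate n x) = x) \<and>
     (\<forall>x\<in>G. \<forall>y\<in>G. opn x (replicate n y) = opn y (replicate n x)) \<and>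
     (\<forall>x\<in>G. \<forall>ys\<in>nlists n G. opn x ys = foldl (\<lambda>z y. opn z (replicate n y)) x ys)"

end

theory Submission
  imports Defs
begin

text \<open>
  Both directions rest on the same observation: the superposition \<open>f[g\<^sub>1 \<dots> g\<^sub>n]\<close> is the greatest lower
  bound of \<open>f, g\<^sub>1, \<dots>, g\<^sub>n\<close>, and the three identities say precisely that a Menger algebra is a
  semilattice whose operation computes such meets.

  Order a Menger algebra \<open>\<Phi>\<close> of interior operations pointwise by inclusion. Contractivity and isotony
  make \<open>f[g\<^sub>1 \<dots> g\<^sub>n]\<close> a lower bound of \<open>f, g\<^sub>1, \<dots>, g\<^sub>n\<close>. If \<open>k\<close> is another lower bound
  and \<open>K = k(X\<^sub>1, \<dots>, X\<^sub>n)\<close>, then idempotence of \<open>k\<close> gives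
  \<open>K = k(K, \<dots>, K) \<subseteq> f(K, \<dots>, K) \<subseteq> f(g\<^sub>1(X\<^sub>1, \<dots>, X\<^sub>n), \<dots>, g\<^sub>n(X\<^sub>1, \<dots>, X\<^sub>n))\<close>, so the
  superposition is the greatest one (\<open>pointwise_le_superposition_iff\<close>). Each of the three identities
  equates two meets of the same elements of \<open>\<Phi>\<close>, hence holds in \<open>\<Phi>\<close> and in every isomorphic copy.

  Conversely, given the identities, \<open>x \<cdot> y = x[y \<dots> y]\<close> is idempotent and commutative, and it is
  associative by superassociativity; the third identity turns \<open>x[y\<^sub>1 \<dots> y\<^sub>n]\<close> into the meet
  \<open>x \<cdot> y\<^sub>1 \<cdot> \<dots> \<cdot> y\<^sub>n\<close>. Representing \<open>g\<close> by \<open>(X\<^sub>1, \<dots>, X\<^sub>n) \<mapsto> \<down>g \<inter> X\<^sub>1 \<inter> \<dots> \<inter> X\<^sub>n\<close> on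
  \<open>A = G\<close>, with \<open>\<down>g\<close> the principal ideal of \<open>g\<close>, yields interior operations. Since the principal ideal
  of a meet is the intersection of the principal ideals, this is a homomorphism, and since an element
  is determined by its principal ideal, it is injective.
\<close>

section \<open>Iterated meets\<close>

text \<open>
  The bridge from binary meets to the left-bracketed product in the third identity. The predicate \<open>r\<close>
  stands for ``lies above a fixed element''; it is instantiated with the pointwise order on
  transformations as well as with the semilattice order of an abstract algebra.
\<close>

lemma foldl_meet_iff:
  assumes closed: "\<And>z y. z \<in> S \<Longrightarrow> y \<in> S \<Longrightarrow> m z y \<in> S"
    and meet: "\<And>z y. z \<in> S \<Longrightarrow> y \<in> S \<Longrightarrow> r (m z y) \<longleftrightarrow> r z \<and> r y"
    and "z \<in> S" "set ys \<subseteq> S"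
  shows "r (foldl m z ys) \<longleftrightarrow> r z \<and> (\<forall>y\<in>set ys. r y)"
  using assms(3,4) by (induction ys arbitrary: z) (auto simp: closed meet)

lemma foldl_closed:
  assumes "\<And>z y. z \<in> S \<Longrightarrow> y \<in> S \<Longrightarrow> m z y \<in> S" and "z \<in> S" "set ys \<subseteq> S"
  shows "foldl m z ys \<in> S"
  using assms(2,3) by (induction ys arbitrary: z) (auto intro: assms(1))

lemma replicate_in_nlists:
  assumes "x \<in> S"
  shows "replicate n x \<in> nlists n S"
proof (rule nlistsI)
  show "set (replicate n x) \<subseteq> S"
    using assms by auto
qed simp

lemma map_in_nlists:
  assumes "xs \<in> nlists n S" "\<And>x. x \<in> S \<Longrightarrow> f x \<in> T"
  shows "map f xs \<in> nlists n T"
proof (rule nlistsI)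
  show "length (map f xs) = n"
    using assms(1) by simp
  show "set (map f xs) \<subseteq> T"
    using nlistsE_set[OF assms(1)] assms(2) by auto
qed

section \<open>Superposition of interior operations as a meet\<close>

definition pointwise_le ::
    "nat \<Rightarrow> 'a set \<Rightarrow> ('a set list \<Rightarrow> 'a set) \<Rightarrow> ('a set list \<Rightarrow> 'a set) \<Rightarrow> bool" where
  "pointwise_le n A f g \<longleftrightarrow> (\<forall>Xs\<in>nlists n (Pow A). f Xs \<subseteq> g Xs)"

lemma pointwise_le_antisym:
  assumes f: "f \<in> transformations n A" and g: "g \<in> transformations n A"
    and "pointwise_le n A f g" "pointwise_le n A g f"
  shows "f = g"
  using f g unfolding transformations_def
  by (rule PiE_ext) (use assms(3,4) in \<open>auto simp: pointwise_le_def\<close>)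

lemma superposition_apply:
  "Xs \<in> nlists n (Pow A) \<Longrightarrow> superposition n A f gs Xs = f (map (\<lambda>g. g Xs) gs)"
  by (simp add: superposition_def)

lemma interior_operation_Pow:
  "interior_operation n A f \<Longrightarrow> Xs \<in> nlists n (Pow A) \<Longrightarrow> f Xs \<in> Pow A"
  unfolding interior_operation_def transformations_def by (elim conjE PiE_mem)

lemma interior_operation_contractive:
  assumes "interior_operation n A f" "Xs \<in> nlists n (Pow A)" "i < n"
  shows "f Xs \<subseteq> Xs ! i"
proof -
  have "Xs ! i \<in> set Xs"
    using assms(2,3) by simp
  then show ?thesis
    using assms(1,2) unfolding interior_operation_def contractive_def by blast
qed

lemma interior_operation_isotone:
  assumes "interior_operation n A f" "Xs \<in> nlists n (Pow A)" "Ys \<in> nlists n (Pow A)"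
    and "\<And>i. i < n \<Longrightarrow> Xs ! i \<subseteq> Ys ! i"
  shows "f Xs \<subseteq> f Ys"
proof -
  have "list_all2 (\<subseteq>) Xs Ys"
    using assms(2-4) by (simp add: list_all2_conv_all_nth)
  then show ?thesis
    using assms(1-3) unfolding interior_operation_def isotone_def by blast
qed

lemma interior_operation_idempotent:
  assumes "interior_operation n A f" "Xs \<in> nlists n (Pow A)"
  shows "f (replicate n (f Xs)) = f Xs"
proof -
  have "superposition n A f (replicate n f) Xs = f Xs"
    using assms(1) unfolding interior_operation_def idempotent_def by metis
  then show ?thesis
    unfolding superposition_apply[OF assms(2)] map_replicate .
qed

text \<open>
  The superposition is a lower bound by contractivity and isotony; it is the greatest one because an
  idempotent \<open>k\<close> fixes its own values, so \<open>k(X\<^sub>1, \<dots>, X\<^sub>n)\<close> survives the application of any operation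
  above \<open>k\<close>.
\<close>

lemma pointwise_le_superposition_iff:
  assumes k: "interior_operation n A k" and f: "interior_operation n A f"
    and gs: "length gs = n" "\<And>g. g \<in> set gs \<Longrightarrow> interior_operation n A g"
  shows "pointwise_le n A k (superposition n A f gs) \<longleftrightarrow>
    pointwise_le n A k f \<and> (\<forall>g\<in>set gs. pointwise_le n A k g)"
proof -
  have args: "map (\<lambda>g. g Xs) gs \<in> nlists n (Pow A)" if "Xs \<in> nlists n (Pow A)" for Xs
  proof (rule nlistsI)
    show "set (map (\<lambda>g. g Xs) gs) \<subseteq> Pow A"
      unfolding set_map by (intro image_subsetI interior_operation_Pow[OF gs(2) that])
  qed (simp add: gs(1))
  have below_f: "pointwise_le n A (superposition n A f gs) f"
    unfolding pointwise_le_def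
  proof
    fix Xs assume Xs: "Xs \<in> nlists n (Pow A)"
    have "f (map (\<lambda>g. g Xs) gs) \<subseteq> f Xs"
    proof (rule interior_operation_isotone[OF f args[OF Xs] Xs])
      fix i assume "i < n"
      then have "(gs ! i) Xs \<subseteq> Xs ! i"
        by (intro interior_operation_contractive[OF gs(2) Xs]) (simp_all add: gs(1))
      with \<open>i < n\<close> show "map (\<lambda>g. g Xs) gs ! i \<subseteq> Xs ! i"
        by (simp add: gs(1))
    qed
    then show "superposition n A f gs Xs \<subseteq> f Xs"
      by (simp add: superposition_apply Xs)
  qed
  have below_g: "pointwise_le n A (superposition n A f gs) g" if g: "g \<in> set gs" for g
    unfolding pointwise_le_def
  proof
    fix Xs assume Xs: "Xs \<in> nlists n (Pow A)"
    obtain i where "i < n" "g = gs ! i"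
      using g gs(1) by (metis in_set_conv_nth)
    then show "superposition n A f gs Xs \<subseteq> g Xs"
      using interior_operation_contractive[OF f args[OF Xs]] gs(1)
      by (simp add: superposition_apply Xs)
  qed
  have greatest: "pointwise_le n A k (superposition n A f gs)"
    if kf: "pointwise_le n A k f" and kg: "\<forall>g\<in>set gs. pointwise_le n A k g"
    unfolding pointwise_le_def
  proof
    fix Xs assume Xs: "Xs \<in> nlists n (Pow A)"
    define Ks where "Ks = replicate n (k Xs)"
    have Ks: "Ks \<in> nlists n (Pow A)"
      unfolding Ks_def by (intro replicate_in_nlists interior_operation_Pow[OF k Xs])
    have "k Xs = k Ks"
      unfolding Ks_def by (rule interior_operation_idempotent[OF k Xs, symmetric])
    also have "\<dots> \<subseteq> f Ks"
      using kf Ks by (simp add: pointwise_le_def)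
    also have "\<dots> \<subseteq> f (map (\<lambda>g. g Xs) gs)"
      using kg gs(1) Xs
      by (intro interior_operation_isotone[OF f Ks args[OF Xs]]) (simp add: pointwise_le_def Ks_def)
    finally show "k Xs \<subseteq> superposition n A f gs Xs"
      by (simp add: superposition_apply Xs)
  qed
  show ?thesis
    using below_f below_g greatest unfolding pointwise_le_def by blast
qed

text \<open>
  Two elements of \<open>\<Phi>\<close> with the same lower bounds in \<open>\<Phi>\<close> are equal, and in each identity the lower
  bounds of either side are the common lower bounds of the variables that occur. The assumption
  \<open>n \<ge> 1\<close> ensures that \<open>y\<close> really occurs in \<open>x[y \<dots> y]\<close>.
\<close>

lemma interior_operation_algebra_identities:
  assumes n: "n \<ge> 1" and \<Phi>: "interior_operation_algebra n A \<Phi>"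
  shows "interior_identities n \<Phi> (superposition n A)"
proof -
  let ?s = "superposition n A" and ?le = "pointwise_le n A"
  have op: "interior_operation n A f" if "f \<in> \<Phi>" for f
    using \<Phi> that by (simp add: interior_operation_algebra_def)
  have closed: "?s f gs \<in> \<Phi>" if "f \<in> \<Phi>" "gs \<in> nlists n \<Phi>" for f gs
    using \<Phi> that by (simp add: interior_operation_algebra_def)
  have meet: "?le k (?s f gs) \<longleftrightarrow> ?le k f \<and> (\<forall>g\<in>set gs. ?le k g)"
    if "k \<in> \<Phi>" "f \<in> \<Phi>" "gs \<in> nlists n \<Phi>" for k f gs
  proof (rule pointwise_le_superposition_iff[OF op[OF that(1)] op[OF that(2)]])
    show "length gs = n"
      using that(3) by simp
    show "interior_operation n A g" if "g \<in> set gs" for g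
      using nlistsE_set[OF \<open>gs \<in> nlists n \<Phi>\<close>] that by (intro op) (rule subsetD)
  qed
  have closed2: "?s f (replicate n g) \<in> \<Phi>" if "f \<in> \<Phi>" "g \<in> \<Phi>" for f g
    using that by (intro closed replicate_in_nlists)
  have meet2: "?le k (?s f (replicate n g)) \<longleftrightarrow> ?le k f \<and> ?le k g"
    if "k \<in> \<Phi>" "f \<in> \<Phi>" "g \<in> \<Phi>" for k f g
    using meet[OF that(1,2) replicate_in_nlists[OF that(3)]] n by simp
  have eqI: "f = g" if "f \<in> \<Phi>" "g \<in> \<Phi>" "\<And>k. k \<in> \<Phi> \<Longrightarrow> ?le k f \<longleftrightarrow> ?le k g" for f g
  proof (rule pointwise_le_antisym)
    show "f \<in> transformations n A" "g \<in> transformations n A"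
      using op[OF that(1)] op[OF that(2)] by (simp_all add: interior_operation_def)
    have "?le f f" "?le g g"
      by (simp_all add: pointwise_le_def)
    then show "?le f g" "?le g f"
      using that by blast+
  qed
  show ?thesis
    unfolding interior_identities_def
  proof (intro conjI ballI)
    fix x assume x: "x \<in> \<Phi>"
    show "?s x (replicate n x) = x"
      by (rule eqI) (simp_all add: x closed2 meet2)
    fix y assume y: "y \<in> \<Phi>"
    show "?s x (replicate n y) = ?s y (replicate n x)"
      by (rule eqI) (auto simp: x y closed2 meet2)
  next
    fix x ys assume x: "x \<in> \<Phi>" and ys: "ys \<in> nlists n \<Phi>"
    show "?s x ys = foldl (\<lambda>z y. ?s z (replicate n y)) x ys"
    proof (rule eqI)
      show "?s x ys \<in> \<Phi>"
        by (rule closed[OF x ys])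
      show "foldl (\<lambda>z y. ?s z (replicate n y)) x ys \<in> \<Phi>"
        using closed2 x nlistsE_set[OF ys] by (rule foldl_closed)
      fix k assume k: "k \<in> \<Phi>"
      have "?le k (foldl (\<lambda>z y. ?s z (replicate n y)) x ys) \<longleftrightarrow> ?le k x \<and> (\<forall>y\<in>set ys. ?le k y)"
        using closed2 meet2[OF k] x nlistsE_set[OF ys] by (rule foldl_meet_iff)
      then show "?le k (?s x ys) \<longleftrightarrow> ?le k (foldl (\<lambda>z y. ?s z (replicate n y)) x ys)"
        by (simp add: meet k x ys)
    qed
  qed
qed

lemma interior_identities_iso:
  assumes G: "menger_algebra n G opn" and P: "menger_iso n G opn H opn' P"
    and H: "interior_identities n H opn'"
  shows "interior_identities n G opn"
proof -
  have PH: "P g \<in> H" if "g \<in> G" for g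
    using P that by (auto simp: menger_iso_def bij_betw_def)
  have eqI: "a = b" if "P a = P b" "a \<in> G" "b \<in> G" for a b
    using P that by (auto simp: menger_iso_def bij_betw_def dest: inj_onD)
  have hom: "P (opn g gs) = opn' (P g) (map P gs)" if "g \<in> G" "gs \<in> nlists n G" for g gs
    using P that by (simp add: menger_iso_def)
  have closed: "opn f gs \<in> G" if "f \<in> G" "gs \<in> nlists n G" for f gs
    using G that by (simp add: menger_algebra_def)
  have closed2: "opn f (replicate n g) \<in> G" if "f \<in> G" "g \<in> G" for f g
    using that by (intro closed replicate_in_nlists)
  have hom2: "P (opn f (replicate n g)) = opn' (P f) (replicate n (P g))"
    if "f \<in> G" "g \<in> G" for f g
    using hom[OF that(1) replicate_in_nlists[OF that(2)]] by simp
  have hom_foldl: "P (foldl (\<lambda>z y. opn z (replicate n y)) x ys)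
      = foldl (\<lambda>z y. opn' z (replicate n y)) (P x) (map P ys)"
    if "x \<in> G" "set ys \<subseteq> G" for x ys
    using that by (induction ys arbitrary: x) (auto simp: hom2 closed2)
  show ?thesis
    unfolding interior_identities_def
  proof (intro conjI ballI)
    fix x assume x: "x \<in> G"
    show "opn x (replicate n x) = x"
      using H by (intro eqI) (simp_all add: x closed2 hom2 PH interior_identities_def)
    fix y assume y: "y \<in> G"
    show "opn x (replicate n y) = opn y (replicate n x)"
      using H by (intro eqI) (simp_all add: x y closed2 hom2 PH interior_identities_def)
  next
    fix x ys assume x: "x \<in> G" and ys: "ys \<in> nlists n G"
    show "opn x ys = foldl (\<lambda>z y. opn z (replicate n y)) x ys"
    proof (rule eqI)
      show "opn x ys \<in> G"
        by (rule closed[OF x ys])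
      show "foldl (\<lambda>z y. opn z (replicate n y)) x ys \<in> G"
        using closed2 x nlistsE_set[OF ys] by (rule foldl_closed)
      have "map P ys \<in> nlists n H"
        by (rule map_in_nlists[OF ys PH])
      then show "P (opn x ys) = P (foldl (\<lambda>z y. opn z (replicate n y)) x ys)"
        using H PH[OF x]
        by (simp add: hom[OF x ys] hom_foldl[OF x nlistsE_set[OF ys]] interior_identities_def)
    qed
  qed
qed

lemma isomorphic_to_interior_operations_identities:
  assumes "n \<ge> 1" "menger_algebra n G opn" "isomorphic_to_interior_operations n G opn A"
  shows "interior_identities n G opn"
proof -
  obtain \<Phi> P where \<Phi>: "interior_operation_algebra n A \<Phi>"
    and P: "menger_iso n G opn \<Phi> (superposition n A) P"
    using assms(3) unfolding isomorphic_to_interior_operations_def by blast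
  have "interior_identities n \<Phi> (superposition n A)"
    using assms(1) \<Phi> by (rule interior_operation_algebra_identities)
  with assms(2) P show ?thesis
    by (rule interior_identities_iso)
qed

section \<open>Representation by principal ideals\<close>

text \<open>
  In the semilattice \<open>x \<cdot> y = x[y \<dots> y]\<close>, the equation \<open>a[g \<dots> g] = a\<close> expresses \<open>a \<le> g\<close>, so the
  value is \<open>\<down>g \<inter> X\<^sub>1 \<inter> \<dots> \<inter> X\<^sub>n\<close>.
\<close>

definition ideal_operation ::
    "nat \<Rightarrow> 'g set \<Rightarrow> ('g \<Rightarrow> 'g list \<Rightarrow> 'g) \<Rightarrow> 'g \<Rightarrow> 'g set list \<Rightarrow> 'g set" where
  "ideal_operation n G opn g =
    (\<lambda>Xs\<in>nlists n (Pow G). {a\<in>G. opn a (replicate n g) = a \<and> (\<forall>X\<in>set Xs. a \<in> X)})"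

lemma ideal_operation_interior: "interior_operation n G (ideal_operation n G opn g)"
proof -
  let ?f = "ideal_operation n G opn g"
  have Pow: "?f Xs \<in> Pow G" if "Xs \<in> nlists n (Pow G)" for Xs
    using that by (auto simp: ideal_operation_def)
  have "?f \<in> transformations n G"
    by (auto simp: transformations_def ideal_operation_def)
  moreover have "contractive n G ?f"
    by (auto simp: contractive_def ideal_operation_def)
  moreover have "idempotent n G ?f"
    unfolding idempotent_def
  proof
    fix Xs
    show "superposition n G ?f (replicate n ?f) Xs = ?f Xs"
    proof (cases "Xs \<in> nlists n (Pow G)")
      case True
      then have "replicate n (?f Xs) \<in> nlists n (Pow G)"
        by (intro replicate_in_nlists Pow)
      with True show ?thesis
        by (cases "n = 0") (auto simp: superposition_apply ideal_operation_def)
    next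
      case False
      then show ?thesis
        by (simp add: superposition_def ideal_operation_def)
    qed
  qed
  moreover have "isotone n G ?f"
    unfolding isotone_def
  proof (intro ballI impI)
    fix Xs Ys assume Xs: "Xs \<in> nlists n (Pow G)" and Ys: "Ys \<in> nlists n (Pow G)"
      and le: "list_all2 (\<subseteq>) Xs Ys"
    have "\<exists>X\<in>set Xs. X \<subseteq> Y" if "Y \<in> set Ys" for Y
      using le that by (metis in_set_conv_nth list_all2_conv_all_nth)
    then show "?f Xs \<subseteq> ?f Ys"
      using Xs Ys by (simp add: ideal_operation_def) blast
  qed
  ultimately show ?thesis
    by (simp add: interior_operation_def)
qed

text \<open>
  The isomorphism onto the image holds because \<open>\<down>(x[y\<^sub>1 \<dots> y\<^sub>n]) = \<down>x \<inter> \<down>y\<^sub>1 \<inter> \<dots> \<inter> \<down>y\<^sub>n\<close>.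
\<close>

lemma ideal_operation_representation:
  assumes n: "n \<ge> 1" and G: "menger_algebra n G opn" and ids: "interior_identities n G opn"
  shows "isomorphic_to_interior_operations n G opn G"
proof -
  define m where "m x y = opn x (replicate n y)" for x y
  define P where "P = ideal_operation n G opn"
  have closed: "opn f gs \<in> G" if "f \<in> G" "gs \<in> nlists n G" for f gs
    using G that by (simp add: menger_algebra_def)
  have m_closed: "m x y \<in> G" if "x \<in> G" "y \<in> G" for x y
    using that unfolding m_def by (intro closed replicate_in_nlists)
  have idem: "m x x = x" if "x \<in> G" for x
    using ids that by (simp add: interior_identities_def m_def)
  have comm: "m x y = m y x" if "x \<in> G" "y \<in> G" for x y
    using ids that by (simp add: interior_identities_def m_def)
  have assoc: "m (m x y) z = m x (m y z)" if "x \<in> G" "y \<in> G" "z \<in> G" for x y z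
  proof -
    have "opn (opn x (replicate n y)) (replicate n z)
        = opn x (map (\<lambda>g. opn g (replicate n z)) (replicate n y))"
      using G that replicate_in_nlists[of y G n] replicate_in_nlists[of z G n]
      unfolding menger_algebra_def by blast
    then show ?thesis
      by (simp add: m_def)
  qed
  have below: "m a (m z y) = a \<longleftrightarrow> m a z = a \<and> m a y = a"
    if a: "a \<in> G" and z: "z \<in> G" and y: "y \<in> G" for a z y
  proof
    assume le: "m a (m z y) = a"
    have "m a y = m (m (m a z) y) y"
      using le by (simp add: assoc a z y)
    also have "\<dots> = m a (m z y)"
      by (simp add: assoc a z y m_closed idem)
    finally have ay: "m a y = a"
      using le by simp
    have "m a z = m (m (m a y) z) z"
      using le by (simp add: assoc a z y comm[of y z])
    also have "\<dots> = m a (m z y)"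
      by (simp add: assoc a z y m_closed idem comm[of z y])
    finally show "m a z = a \<and> m a y = a"
      using le ay by simp
  next
    assume "m a z = a \<and> m a y = a"
    then show "m a (m z y) = a"
      using assoc[OF a z y] by simp
  qed
  have below_opn: "m a (opn x ys) = a \<longleftrightarrow> m a x = a \<and> (\<forall>y\<in>set ys. m a y = a)"
    if a: "a \<in> G" and x: "x \<in> G" and ys: "ys \<in> nlists n G" for a x ys
  proof -
    have "opn x ys = foldl m x ys"
      using ids x ys by (simp add: interior_identities_def m_def[abs_def])
    moreover have "m a (foldl m x ys) = a \<longleftrightarrow> m a x = a \<and> (\<forall>y\<in>set ys. m a y = a)"
      by (rule foldl_meet_iff[where r = "\<lambda>g. m a g = a", OF m_closed below[OF a] x nlistsE_set[OF ys]])
    ultimately show ?thesis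
      by simp
  qed
  have P_apply: "P g Xs = {a\<in>G. m a g = a \<and> (\<forall>X\<in>set Xs. a \<in> X)}"
    if "Xs \<in> nlists n (Pow G)" for g Xs
    using that by (simp add: P_def ideal_operation_def m_def)
  have P_hom: "P (opn g gs) = superposition n G (P g) (map P gs)"
    if g: "g \<in> G" and gs: "gs \<in> nlists n G" for g gs
  proof
    fix Xs
    show "P (opn g gs) Xs = superposition n G (P g) (map P gs) Xs"
    proof (cases "Xs \<in> nlists n (Pow G)")
      case True
      have args: "map (\<lambda>h. P h Xs) gs \<in> nlists n (Pow G)"
        by (rule map_in_nlists[OF gs]) (auto simp: P_apply True)
      \<comment> \<open>The condition that \<open>a\<close> lies in all arguments is inherited from any one inner operation.\<close>
      have "gs \<noteq> []"
        using nlistsE_length[OF gs] n by auto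
      then obtain h where h: "h \<in> set gs"
        by (meson list.set_sel(1))
      have "superposition n G (P g) (map P gs) Xs = P g (map (\<lambda>h. P h Xs) gs)"
        by (simp add: superposition_apply True comp_def)
      also have "\<dots> = {a\<in>G. m a g = a \<and> (\<forall>h\<in>set gs. a \<in> P h Xs)}"
        by (simp add: P_apply[OF args])
      also have "\<dots> = {a\<in>G. (m a g = a \<and> (\<forall>h\<in>set gs. m a h = a)) \<and> (\<forall>X\<in>set Xs. a \<in> X)}"
        unfolding P_apply[OF True] using h by blast
      finally have "superposition n G (P g) (map P gs) Xs
          = {a\<in>G. (m a g = a \<and> (\<forall>h\<in>set gs. m a h = a)) \<and> (\<forall>X\<in>set Xs. a \<in> X)}" .
      then show ?thesis
        using below_opn[OF _ g gs] by (auto simp: P_apply True)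
    next
      case False
      then show ?thesis
        by (simp add: superposition_def P_def ideal_operation_def)
    qed
  qed
  have "inj_on P G"
  proof (rule inj_onI)
    fix x y assume x: "x \<in> G" and y: "y \<in> G" and eq: "P x = P y"
    \<comment> \<open>Evaluating at \<open>(G, \<dots>, G)\<close> recovers the principal ideal.\<close>
    have top: "replicate n G \<in> nlists n (Pow G)"
      by (simp add: replicate_in_nlists)
    have ideal: "P g (replicate n G) = {a\<in>G. m a g = a}" for g
      by (auto simp: P_apply[OF top])
    have "{a\<in>G. m a x = a} = {a\<in>G. m a y = a}"
      using eq ideal by metis
    then have "m x y = x" "m y x = y"
      using x y idem by blast+
    then show "x = y"
      using comm[OF x y] by simp
  qed
  then have "menger_iso n G opn (P ` G) (superposition n G) P"
    by (simp add: menger_iso_def inj_on_imp_bij_betw P_hom)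
  moreover have "interior_operation_algebra n G (P ` G)"
  proof -
    have "superposition n G f hs \<in> P ` G" if "f \<in> P ` G" "hs \<in> nlists n (P ` G)" for f hs
    proof -
      obtain g where g: "g \<in> G" "f = P g"
        using \<open>f \<in> P ` G\<close> by blast
      define gs where "gs = map (inv_into G P) hs"
      have gs: "gs \<in> nlists n G"
        unfolding gs_def using that(2) by (rule map_in_nlists) (rule inv_into_into)
      have "P (inv_into G P h) = h" if "h \<in> set hs" for h
        using nlistsE_set[OF \<open>hs \<in> nlists n (P ` G)\<close>] that by (intro f_inv_into_f) (rule subsetD)
      then have "map P gs = hs"
        by (simp add: gs_def map_idI)
      with P_hom[OF g(1) gs] closed[OF g(1) gs]
      have "superposition n G f hs = P (opn g gs)" "opn g gs \<in> G"
        by (simp_all add: g(2))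
      then show ?thesis
        by simp
    qed
    moreover have "G \<noteq> {}"
      using G by (simp add: menger_algebra_def)
    moreover have "interior_operation n G f" if "f \<in> P ` G" for f
      using that ideal_operation_interior by (auto simp: P_def)
    ultimately show ?thesis
      by (simp add: interior_operation_algebra_def)
  qed
  ultimately show ?thesis
    unfolding isomorphic_to_interior_operations_def by (intro exI conjI)
qed

section \<open>The characterization\<close>

theorem theorem6p1:
  fixes n :: nat and G :: "'g set" and opn :: "'g \<Rightarrow> 'g list \<Rightarrow> 'g"
  assumes "n \<ge> 1" and "menger_algebra n G opn"
  shows "((\<exists>A::'g set. isomorphic_to_interior_operations n G opn A) \<longleftrightarrow> interior_identities n G opn)
    \<and> (\<forall>A::'a set. isomorphic_to_interior_operations n G opn A \<longrightarrow> interior_identities n G opn)"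
proof (intro conjI iffI allI impI)
  assume "\<exists>A::'g set. isomorphic_to_interior_operations n G opn A"
  then show "interior_identities n G opn"
    by (elim exE) (rule isomorphic_to_interior_operations_identities[OF assms])
next
  assume "interior_identities n G opn"
  with assms show "\<exists>A::'g set. isomorphic_to_interior_operations n G opn A"
    by (intro exI) (rule ideal_operation_representation)
next
  fix A :: "'a set"
  assume "isomorphic_to_interior_operations n G opn A"
  with assms show "interior_identities n G opn"
    by (rule isomorphic_to_interior_operations_identities)
qed

end
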